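(* Let $G$ be a connected graph of order $n\geq 3$. Then $tpc(G)=n-1$ if and only if $G$ is isomorphic to one of the graphs $T(2,n-2)$, $C_4$, $C_4+e$, $S_4+e$.
   Context: All graphs are simple, finite and undirected. A total-coloring of a graph $G$ assigns a color to every vertex and every edge of $G$ (with no properness requirement). A path $P$ in a total-colored graph is a total-proper path if (i) any two adjacent edges of $P$ have distinct colors; (ii) any two adjacent internal vertices of $P$ have distinct colors; (iii) any internal vertex of $P$ has a color distinct from the colors of its incident edges of $P$. The total-colored graph $G$ is total-proper connected if any two distinct vertices of $G$ are connected by a total-proper path. For a nontrivial connected graph $G$, the total-proper connection number $tpc(G)$ is the minimum number of colors in a total-coloring that makes $G$ total-proper connected. $C_n$ and $S_n$ denote the cycle and the star on $n$ vertices, respectively. For $a,b\geq 2$, $T(a,b)$ denotes the double star obtained from disjoint stars $S_a$ and $S_b$ by adding an edge between their center vertices (for $S_2$ either vertex may be taken as the center); so for $n\ge 4$, $T(2,n-2)$ is the tree on $n$ vertices with maximum degree $n-2$, and $T(2,n-2)$ is not defined for $n=3$. For a nontrivial graph $G$ in which adding an edge between any two nonadjacent vertices always gives the same graph up to isomorphism, $G+e$ denotes the graph obtained from $G$ by joining two nonadjacent vertices. Thus $C_4+e$ is the $4$-cycle with one chord, and $S_4+e$ is a triangle with one pendant edge attached. *)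

theory Defs
  imports "Graph_Theory.Graph_Theory"
begin

text \<open>
  Simple finite undirected graphs are modelled as in the library: a loopless symmetric digraph
  without parallel arcs, i.e. a \<open>pair_graph\<close>. Its undirected edges are recovered as two-element
  sets, so that both arcs of an edge always carry the same color.
\<close>

definition uedges :: "'a pair_pre_digraph \<Rightarrow> 'a set set" where
  "uedges G = {{u, v} | u v. (u, v) \<in> parcs G}"

text \<open>
  Colors are natural numbers; \<open>Inl v\<close> stands for the vertex \<open>v\<close> and \<open>Inr e\<close> for the edge \<open>e\<close>.
  Only the values on the elements of the graph matter.
\<close>

type_synonym 'a total_coloring = "'a + 'a set \<Rightarrow> nat"

definition used_colors :: "'a pair_pre_digraph \<Rightarrow> 'a total_coloring \<Rightarrow> nat set" where
  "used_colors G c = c ` (pverts G <+> uedges G)"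

text \<open>
  A path is given by its list of vertices. The internal vertices are those at the positions
  \<open>1, \<dots>, length p - 2\<close>.
\<close>

definition total_proper_path :: "'a pair_pre_digraph \<Rightarrow> 'a total_coloring \<Rightarrow> 'a list \<Rightarrow> bool" where
  "total_proper_path G c p \<longleftrightarrow>
     vpath p (with_proj G) \<and>
     (\<forall>i. i + 2 < length p \<longrightarrow>
        c (Inr {p ! i, p ! (i + 1)}) \<noteq> c (Inr {p ! (i + 1), p ! (i + 2)})) \<and>
     (\<forall>i. 1 \<le> i \<and> i + 2 < length p \<longrightarrow>
        c (Inl (p ! i)) \<noteq> c (Inl (p ! (i + 1)))) \<and>
     (\<forall>i. i + 2 < length p \<longrightarrow>
        c (Inl (p ! (i + 1))) \<noteq> c (Inr {p ! i, p ! (i + 1)}) \<and>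
        c (Inl (p ! (i + 1))) \<noteq> c (Inr {p ! (i + 1), p ! (i + 2)}))"

definition total_proper_connected :: "'a pair_pre_digraph \<Rightarrow> 'a total_coloring \<Rightarrow> bool" where
  "total_proper_connected G c \<longleftrightarrow>
     (\<forall>u \<in> pverts G. \<forall>v \<in> pverts G. u \<noteq> v \<longrightarrow>
        (\<exists>p. total_proper_path G c p \<and> hd p = u \<and> last p = v))"

definition tpc :: "'a pair_pre_digraph \<Rightarrow> nat" where
  "tpc G = (LEAST k. \<exists>c. total_proper_connected G c \<and> card (used_colors G c) = k)"

definition cycle_graph :: "nat \<Rightarrow> nat pair_pre_digraph" where
  "cycle_graph n = \<lparr> pverts = {0..<n}, parcs = symcl {(i, (i + 1) mod n) | i. i < n} \<rparr>"

definition star_graph :: "nat \<Rightarrow> nat pair_pre_digraph" where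
  "star_graph n = \<lparr> pverts = {0..<n}, parcs = symcl {(0, i) | i. 1 \<le> i \<and> i < n} \<rparr>"

definition disjoint_union :: "'a pair_pre_digraph \<Rightarrow> 'b pair_pre_digraph \<Rightarrow> ('a + 'b) pair_pre_digraph" where
  "disjoint_union G H =
     \<lparr> pverts = pverts G <+> pverts H,
       parcs = {(Inl u, Inl v) | u v. (u, v) \<in> parcs G} \<union> {(Inr u, Inr v) | u v. (u, v) \<in> parcs H} \<rparr>"

definition add_edge :: "'a pair_pre_digraph \<Rightarrow> 'a \<Rightarrow> 'a \<Rightarrow> 'a pair_pre_digraph" where
  "add_edge G u v = \<lparr> pverts = pverts G, parcs = parcs G \<union> {(u, v), (v, u)} \<rparr>"

text \<open>The center of \<open>star_graph n\<close> is the vertex \<open>0\<close>. Intended for \<open>a, b \<ge> 2\<close>.\<close>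

definition double_star :: "nat \<Rightarrow> nat \<Rightarrow> (nat + nat) pair_pre_digraph" where
  "double_star a b = add_edge (disjoint_union (star_graph a) (star_graph b)) (Inl 0) (Inr 0)"

text \<open>
  In \<open>C\<^sub>4\<close> the nonadjacent pairs are the two diagonals, in \<open>S\<^sub>4\<close> the pairs of leaves; up to
  isomorphism it does not matter which pair is joined.
\<close>

definition C4_plus_e :: "nat pair_pre_digraph" where
  "C4_plus_e = add_edge (cycle_graph 4) 0 2"

definition S4_plus_e :: "nat pair_pre_digraph" where
  "S4_plus_e = add_edge (star_graph 4) 1 2"

lemma pair_graph_star_graph: "pair_graph (star_graph n)"
proof unfold_locales
  show "finite (parcs (star_graph n))"
    by (rule finite_subset[of _ "{0..<n} \<times> {0..<n}"]) (auto simp: star_graph_def symcl_def)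
qed (auto simp: star_graph_def symcl_def symmetric_def sym_def)

lemma pair_graph_cycle_graph:
  assumes "n \<ge> 3"
  shows "pair_graph (cycle_graph n)"
proof unfold_locales
  show "finite (parcs (cycle_graph n))"
    by (rule finite_subset[of _ "{0..<n} \<times> {0..<n}"]) (auto simp: cycle_graph_def symcl_def)
next
  have "i \<noteq> Suc i mod n" if "i < n" for i
    using that assms by (cases "Suc i = n") auto
  then show "fst e \<noteq> snd e" if "e \<in> parcs (cycle_graph n)" for e
    using that by (force simp: cycle_graph_def symcl_def)
qed (auto simp: cycle_graph_def symcl_def symmetric_def sym_def)

lemma pair_graph_add_edge:
  assumes "pair_graph G" "u \<in> pverts G" "v \<in> pverts G" "u \<noteq> v"
  shows "pair_graph (add_edge G u v)"
proof -
  interpret pair_graph G by fact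
  show ?thesis
    using assms(2-4) pair_finite_verts pair_finite_arcs
    by unfold_locales
      (auto simp: add_edge_def symmetric_def sym_def dest: in_arcsD1 in_arcsD2 arcs_symmetric no_loops')
qed

lemma pair_graph_disjoint_union:
  assumes "pair_graph G" "pair_graph H"
  shows "pair_graph (disjoint_union G H)"
proof -
  interpret G: pair_graph G by fact
  interpret H: pair_graph H by fact
  have "finite (parcs (disjoint_union G H))"
    by (rule finite_subset[of _ "(pverts G <+> pverts H) \<times> (pverts G <+> pverts H)"])
      (auto simp: disjoint_union_def G.pair_finite_verts H.pair_finite_verts
        dest: G.in_arcsD1 G.in_arcsD2 H.in_arcsD1 H.in_arcsD2)
  then show ?thesis
    by unfold_locales
      (auto simp: disjoint_union_def symmetric_def sym_def G.pair_finite_verts H.pair_finite_verts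
        dest: G.in_arcsD1 G.in_arcsD2 H.in_arcsD1 H.in_arcsD2 G.arcs_symmetric H.arcs_symmetric
          G.no_loops' H.no_loops')
qed

lemma pair_graph_double_star: "a \<ge> 1 \<Longrightarrow> b \<ge> 1 \<Longrightarrow> pair_graph (double_star a b)"
  unfolding double_star_def
  by (intro pair_graph_add_edge pair_graph_disjoint_union pair_graph_star_graph)
    (auto simp: disjoint_union_def star_graph_def)

lemma pair_graph_C4_plus_e: "pair_graph C4_plus_e"
  unfolding C4_plus_e_def
  by (intro pair_graph_add_edge pair_graph_cycle_graph) (auto simp: cycle_graph_def)

lemma pair_graph_S4_plus_e: "pair_graph S4_plus_e"
  unfolding S4_plus_e_def
  by (intro pair_graph_add_edge pair_graph_star_graph) (auto simp: star_graph_def)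

end

theory Submission
  imports Defs
begin

text \<open>
  The upper bounds come from growing a coloring outwards. Call a path fully proper if adjacent
  vertices, adjacent edges, and vertices and their incident edges have distinct colors, the two end
  vertices included. Suppose that a vertex set \<open>W\<close> is colored with \<open>k\<close> colors so that any two of its vertices are
  joined inside \<open>W\<close> by a fully proper path. A neighbor of \<open>W\<close> can then be attached through a single
  edge that gets a new color, because nothing on the old paths clashes with it
  (\<open>fully_colorable_insert\<close>). So in a connected graph of order \<open>n\<close> every such seed gives
  \<open>tpc G \<le> k + (n - \<bar>W\<bar>)\<close> (\<open>tpc_le_of_seed\<close>), and only the difference \<open>\<bar>W\<bar> - k\<close> matters. A path on four
  vertices is colored with three colors and yields \<open>tpc G \<le> n - 1\<close>. Three seeds save one more color and
  yield \<open>tpc G \<le> n - 2\<close>: the path on five vertices (three colors), the triangle with two pendant edges at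
  the same vertex (three colors), and the double star \<open>T(3, 3)\<close> on six vertices (four colors).

  The lower bounds have two sources. Two nonadjacent vertices force three colors, since the first
  internal vertex of a path between them differs from both its edges, and these differ from each
  other. If all neighbors of \<open>x\<close> but at most one are leaves, then any path between two neighbors runs
  straight through \<open>x\<close>, so the edges at \<open>x\<close> and \<open>x\<close> itself have pairwise distinct colors and
  \<open>tpc G \<ge> deg x + 1\<close> (\<open>tpc_ge_degree\<close>). This settles stars, where \<open>tpc G = n\<close>, and \<open>T(2, n - 2)\<close>.

  It remains to see that \<open>tpc G = n - 1\<close> leaves only the listed graphs. The graph is not complete,
  hence \<open>n - 1 \<ge> 3\<close>; it is not a star, hence it contains a path on four vertices
  (\<open>star_if_no_path4\<close>). For \<open>n = 4\<close>,
  the three possible further edges are inspected case by case. For \<open>n \<ge> 5\<close>, a fifth vertex must be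
  attached to an inner vertex of the path, which gives a path \<open>a, b, c\<close> with two further neighbors
  at \<open>c\<close>; every edge other than those of \<open>T(2, n - 2)\<close> would complete one of the three
  color-saving seeds (\<open>broom_if_fork\<close>).
\<close>

section \<open>Fully proper paths\<close>

text \<open>
  Unlike for a total-proper path, the conditions on colors extend to the two end vertices. Then a path
  can be prolonged beyond its ends without recoloring.
\<close>
fun fully_proper :: "'a pair_pre_digraph \<Rightarrow> 'a total_coloring \<Rightarrow> 'a list \<Rightarrow> bool" where
  "fully_proper G c [] \<longleftrightarrow> False"
| "fully_proper G c [x] \<longleftrightarrow> x \<in> pverts G"
| "fully_proper G c (x # y # p) \<longleftrightarrow>
     (x, y) \<in> parcs G \<and> x \<noteq> y \<and> x \<notin> set p \<and>
     c (Inl x) \<noteq> c (Inl y) \<and> c (Inl x) \<noteq> c (Inr {x, y}) \<and> c (Inl y) \<noteq> c (Inr {x, y}) \<and>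
     (p \<noteq> [] \<longrightarrow> c (Inr {x, y}) \<noteq> c (Inr {y, hd p})) \<and>
     fully_proper G c (y # p)"

lemma fully_proper_prefix:
  assumes "fully_proper G c (p @ q)" "p \<noteq> []" "pair_graph G"
  shows "fully_proper G c p"
  using assms(1,2)
proof (induction p rule: induct_list012)
  case (2 x)
  then show ?case
    using pair_wf_digraph.in_arcsD1[of G] assms(3)
    by (cases q) (auto simp: pair_graph_def pair_digraph_def pair_fin_digraph_def)
next
  case (3 x y p)
  then show ?case by (cases p) auto
qed simp

lemma fully_proper_suffix:
  assumes "fully_proper G c (p @ q)" "q \<noteq> []"
  shows "fully_proper G c q"
  using assms
proof (induction p rule: induct_list012)
  case (2 x)
  then show ?case by (cases q) auto
qed auto

text \<open>
  Recoloring outside the subgraph induced by \<open>W\<close> does not affect the paths inside \<open>W\<close>.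
\<close>
lemma fully_proper_cong:
  assumes "set p \<subseteq> W" "\<And>x. x \<in> W \<Longrightarrow> c' (Inl x) = c (Inl x)"
    and "\<And>e. e \<subseteq> W \<Longrightarrow> c' (Inr e) = c (Inr e)"
  shows "fully_proper G c' p \<longleftrightarrow> fully_proper G c p"
  using assms(1)
proof (induction p rule: induct_list012)
  case (3 x y p)
  then have "p \<noteq> [] \<Longrightarrow> {y, hd p} \<subseteq> W" by (cases p) auto
  with 3 show ?case by (auto simp: assms(2,3))
qed auto

lemma fully_proper_snoc:
  assumes "fully_proper G c (p @ [y])" "(y, x) \<in> parcs G" "x \<noteq> y" "x \<notin> set p" "x \<in> pverts G"
    and "c (Inl x) \<noteq> c (Inl y)" "c (Inl x) \<noteq> c (Inr {x, y})" "c (Inl y) \<noteq> c (Inr {x, y})"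
    and "p \<noteq> [] \<longrightarrow> c (Inr {last p, y}) \<noteq> c (Inr {y, x})"
  shows "fully_proper G c (p @ [y, x])"
  using assms
proof (induction p rule: induct_list012)
  case (3 u v p)
  then show ?case by (cases p) auto
qed (auto simp: insert_commute)

lemma fully_proper_rev:
  assumes "pair_graph G" "fully_proper G c p"
  shows "fully_proper G c (rev p)"
  using assms(2)
proof (induction p rule: induct_list012)
  case (3 x y p)
  interpret pair_graph G by fact
  have "fully_proper G c (rev p @ [y, x])"
  proof (rule fully_proper_snoc)
    show "rev p \<noteq> [] \<longrightarrow> c (Inr {last (rev p), y}) \<noteq> c (Inr {y, x})"
      using 3 by (auto simp: last_rev insert_commute)
  qed (use 3 in \<open>auto simp: arcs_symmetric intro: in_arcsD1\<close>)
  then show ?case by simp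
qed auto

lemma fully_proper_vpath:
  assumes "pair_graph G" "fully_proper G c p"
  shows "vpath p (with_proj G)"
proof -
  interpret pair_graph G by fact
  show ?thesis using assms(2)
    by (induction p rule: induct_list012) (auto simp: vpath_def vwalk_def in_arcsD1)
qed

lemma fully_proper_nth:
  assumes "fully_proper G c p" "Suc i < length p"
  shows "c (Inl (p ! i)) \<noteq> c (Inl (p ! Suc i))" "c (Inl (p ! i)) \<noteq> c (Inr {p ! i, p ! Suc i})"
    "c (Inl (p ! Suc i)) \<noteq> c (Inr {p ! i, p ! Suc i})"
  using assms
proof (induction p arbitrary: i rule: induct_list012)
  case (3 x y p)
  { case 1 with 3 show ?case by (cases i) auto }
  { case 2 with 3 show ?case by (cases i) auto }
  { case 3 with "3.IH" "3.prems" show ?case by (cases i) auto }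
qed auto

lemma fully_proper_nth_edges:
  assumes "fully_proper G c p" "i + 2 < length p"
  shows "c (Inr {p ! i, p ! (i + 1)}) \<noteq> c (Inr {p ! (i + 1), p ! (i + 2)})"
  using assms
proof (induction p arbitrary: i rule: induct_list012)
  case (3 x y p)
  then show ?case by (cases i; cases p) auto
qed auto

lemma fully_proper_total_proper:
  assumes "pair_graph G" "fully_proper G c p"
  shows "total_proper_path G c p"
  unfolding total_proper_path_def
  using fully_proper_vpath[OF assms] fully_proper_nth[OF assms(2)] fully_proper_nth_edges[OF assms(2)]
  by (auto simp: numeral_2_eq_2)

section \<open>Growing a coloring\<close>

text \<open>
  The bound is imposed on all values of the coloring, including those outside \<open>W\<close>, so that \<open>k\<close> itself
  is a fresh color.
\<close>
definition fully_colorable :: "'a pair_pre_digraph \<Rightarrow> 'a set \<Rightarrow> nat \<Rightarrow> bool" where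
  "fully_colorable G W k \<longleftrightarrow> W \<noteq> {} \<and>
     (\<exists>c. (\<forall>s. c s < k) \<and>
       (\<forall>u \<in> W. \<forall>v \<in> W. \<exists>p. fully_proper G c p \<and> set p \<subseteq> W \<and> hd p = u \<and> last p = v))"

text \<open>
  Segments and reversals of fully proper paths are fully proper.
\<close>
lemma fully_proper_covered_pair:
  assumes "pair_graph G" "fully_proper G c p" "u \<in> set p" "v \<in> set p"
  shows "\<exists>q. fully_proper G c q \<and> set q \<subseteq> set p \<and> hd q = u \<and> last q = v"
proof -
  interpret pair_graph G by fact
  obtain p1 p2 where p: "p = p1 @ u # p2" using assms(3) by (meson split_list)
  consider "v \<in> set (u # p2)" | "v \<in> set p1" using assms(4) p by auto
  then show ?thesis
  proof cases
    case 1
    then obtain q1 q2 where q: "u # p2 = q1 @ v # q2" by (meson split_list)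
    have "fully_proper G c ((q1 @ [v]) @ q2)"
      using fully_proper_suffix[of G c p1 "u # p2"] assms(2) p q by simp
    then have "fully_proper G c (q1 @ [v])" by (rule fully_proper_prefix) (use assms in auto)
    moreover have "hd (q1 @ [v]) = u" using q by (cases q1) auto
    moreover have "set p = set p1 \<union> set (q1 @ v # q2)" using p q by simp
    ultimately show ?thesis by (intro exI[of _ "q1 @ [v]"]) auto
  next
    case 2
    then obtain q1 q2 where q: "p1 = q1 @ v # q2" by (meson split_list)
    have "fully_proper G c ((v # q2 @ [u]) @ p2)"
      using fully_proper_suffix[of G c q1 "v # q2 @ u # p2"] assms(2) p q by simp
    then have "fully_proper G c (v # q2 @ [u])" by (rule fully_proper_prefix) (use assms in auto)
    then have "fully_proper G c (rev (v # q2 @ [u]))" by (rule fully_proper_rev[OF assms(1)])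
    then show ?thesis using p q by (intro exI[of _ "rev (v # q2 @ [u])"]) auto
  qed
qed

lemma fully_colorable_if_covered:
  assumes "pair_graph G" "W \<noteq> {}" "\<And>s. c s < k"
    and "\<And>u v. u \<in> W \<Longrightarrow> v \<in> W \<Longrightarrow> \<exists>p. fully_proper G c p \<and> set p \<subseteq> W \<and> u \<in> set p \<and> v \<in> set p"
  shows "fully_colorable G W k"
  unfolding fully_colorable_def
proof (intro conjI exI[of _ c] ballI)
  fix u v assume "u \<in> W" "v \<in> W"
  then obtain p where p: "fully_proper G c p" "set p \<subseteq> W" "u \<in> set p" "v \<in> set p"
    using assms(4) by blast
  obtain q where "fully_proper G c q" "set q \<subseteq> set p" "hd q = u" "last q = v"
    using fully_proper_covered_pair[OF assms(1) p(1,3,4)] by blast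
  then show "\<exists>p. fully_proper G c p \<and> set p \<subseteq> W \<and> hd p = u \<and> last p = v"
    using p(2) by blast
qed (use assms in auto)

text \<open>
  The new edge gets the fresh color \<open>k\<close>, and \<open>v\<close> gets a color different from that of \<open>u\<close>, which exists
  because of \<open>2 \<le> k\<close>. Any path inside \<open>W\<close> that starts at \<open>u\<close> can then be prolonged to \<open>v\<close>.
\<close>
lemma fully_colorable_insert:
  assumes "pair_graph G" "fully_colorable G W k" "2 \<le> k" "u \<in> W" "v \<notin> W" "(v, u) \<in> parcs G"
  shows "fully_colorable G (insert v W) (Suc k)"
proof -
  interpret pair_graph G by fact
  obtain c where c: "\<And>s. c s < k"
    and linked: "\<And>x y. x \<in> W \<Longrightarrow> y \<in> W \<Longrightarrow> \<exists>p. fully_proper G c p \<and> set p \<subseteq> W \<and> hd p = x \<and> last p = y"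
    using assms(2) unfolding fully_colorable_def by blast
  define d where "d = c(Inl v := if c (Inl u) = 0 then 1 else 0, Inr {v, u} := k)"
  have cong: "fully_proper G d p \<longleftrightarrow> fully_proper G c p" if "set p \<subseteq> W" for p
    by (rule fully_proper_cong[OF that]) (use \<open>v \<notin> W\<close> in \<open>auto simp: d_def\<close>)
  have via_u: "\<exists>p. fully_proper G d p \<and> set p \<subseteq> insert v W \<and> v \<in> set p \<and> y \<in> set p"
    if y: "y \<in> W" for y
  proof -
    obtain p where p: "fully_proper G c p" "set p \<subseteq> W" "hd p = u" "last p = y"
      using linked[OF \<open>u \<in> W\<close> y] by blast
    obtain q where q: "p = u # q" using p by (cases p) auto
    have "u \<noteq> v" using assms by auto
    have new: "d (Inr {v, u}) \<noteq> d (Inr {u, hd q})" if "q \<noteq> []"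
    proof -
      have "hd q \<noteq> v" using that p(2) q \<open>v \<notin> W\<close> by (cases q) auto
      then have "d (Inr {u, hd q}) = c (Inr {u, hd q})" by (auto simp: d_def doubleton_eq_iff)
      then show ?thesis using c[of "Inr {u, hd q}"] by (simp add: d_def)
    qed
    have "fully_proper G d p" using p cong by blast
    moreover have "d (Inl u) < k" "d (Inl v) < k" "d (Inl u) \<noteq> d (Inl v)"
      using c \<open>2 \<le> k\<close> \<open>u \<noteq> v\<close> by (auto simp: d_def)
    moreover have "d (Inr {v, u}) = k" by (simp add: d_def)
    moreover have "v \<notin> set p" using p assms by auto
    ultimately have "fully_proper G d (v # p)"
      using q new assms(6) \<open>u \<noteq> v\<close> by (simp add: insert_commute)
    moreover have "y \<in> set p" using p q by auto
    ultimately show ?thesis using p(2) by (intro exI[of _ "v # p"]) auto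
  qed
  show ?thesis
  proof (rule fully_colorable_if_covered[where c = d])
    show "d s < Suc k" for s using c[of s] \<open>2 \<le> k\<close> by (auto simp: d_def)
  next
    fix x y assume xy: "x \<in> insert v W" "y \<in> insert v W"
    consider "x \<in> W" "y \<in> W" | "x = v" "y \<in> W" | "y = v" "x \<in> W" | "x = v" "y = v" using xy by blast
    then show "\<exists>p. fully_proper G d p \<and> set p \<subseteq> insert v W \<and> x \<in> set p \<and> y \<in> set p"
    proof cases
      case 1
      then obtain p where "fully_proper G c p" "set p \<subseteq> W" "hd p = x" "last p = y" using linked by blast
      moreover from this have "p \<noteq> []" by auto
      ultimately show ?thesis using cong by (intro exI[of _ p]) (auto simp del: fully_proper.simps)
    qed (use via_u assms(4) in blast)+
  qed (use assms in auto)
qed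

context pair_graph
begin

lemma crossing_arc:
  assumes "connected G" "W \<subset> pverts G" "W \<noteq> {}"
  obtains u v where "u \<in> W" "v \<in> pverts G - W" "(v, u) \<in> parcs G"
proof -
  have sc: "strongly_connected G"
    using assms(1) by (simp add: symmetric_connected_imp_strongly_connected pair_sym_arcs)
  obtain a b where ab: "a \<in> W" "b \<in> pverts G - W" using assms by blast
  then have "a \<rightarrow>\<^sup>*\<^bsub>with_proj G\<^esub> b" using sc assms(2) by (auto elim!: strongly_connectedE)
  then have "\<exists>u v. u \<in> W \<and> v \<in> pverts G - W \<and> (u, v) \<in> parcs G" using ab
  proof (induction rule: reachable_induct)
    case (step x y)
    show ?case
    proof (cases "x \<in> W")
      case True
      then show ?thesis using step.hyps(2) step.prems by (intro exI[of _ x] exI[of _ y]) simp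
    next
      case False
      have "x \<in> pverts G" using step.hyps(2) by (simp add: in_arcsD1)
      then show ?thesis using step.IH step.prems(1) False by simp
    qed
  qed auto
  then show thesis using that arcs_symmetric by blast
qed

lemma fully_colorable_span:
  assumes "connected G" "fully_colorable G W k" "2 \<le> k" "W \<subseteq> pverts G"
  shows "fully_colorable G (pverts G) (k + card (pverts G - W))"
  using assms
proof (induction "card (pverts G - W)" arbitrary: W k)
  case 0
  then have "W = pverts G" using pair_finite_verts by auto
  with 0 show ?case by simp
next
  case (Suc m)
  have ne: "W \<noteq> {}" using Suc by (auto simp: fully_colorable_def)
  have "W \<subset> pverts G" using Suc by auto
  then obtain u v where uv: "u \<in> W" "v \<in> pverts G - W" "(v, u) \<in> parcs G"
    using crossing_arc[OF Suc(3)] ne by blast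
  have "pverts G - insert v W = (pverts G - W) - {v}" by auto
  then have card: "card (pverts G - insert v W) = m" using Suc(2) uv by simp
  have "fully_colorable G (insert v W) (Suc k)"
    by (rule fully_colorable_insert[OF pair_graph_axioms]) (use Suc uv in auto)
  then have "fully_colorable G (pverts G) (Suc k + card (pverts G - insert v W))"
    by (intro Suc(1)) (use Suc uv card in auto)
  then show ?case using card by (simp flip: Suc(2))
qed

lemma used_colors_bounded:
  assumes "\<And>s. c s < k"
  shows "card (used_colors G c) \<le> k"
proof -
  have "used_colors G c \<subseteq> {..<k}" using assms by (auto simp: used_colors_def)
  from card_mono[OF _ this] show ?thesis by simp
qed

lemma fully_colorable_imp_proper_coloring:
  assumes "fully_colorable G (pverts G) k"
  shows "\<exists>c. total_proper_connected G c \<and> card (used_colors G c) \<le> k"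
  using assms used_colors_bounded fully_proper_total_proper[OF pair_graph_axioms]
  unfolding fully_colorable_def total_proper_connected_def by meson

lemma tpc_le_card_used_colors:
  "total_proper_connected G c \<Longrightarrow> tpc G \<le> card (used_colors G c)"
  unfolding tpc_def by (rule Least_le) auto

lemma tpc_le_of_seed:
  assumes "connected G" "fully_colorable G W k" "2 \<le> k" "W \<subseteq> pverts G"
  shows "tpc G \<le> k + (card (pverts G) - card W)"
proof -
  have "card (pverts G - W) = card (pverts G) - card W"
    using assms(4) pair_finite_verts by (simp add: card_Diff_subset finite_subset)
  then show ?thesis
    using fully_colorable_imp_proper_coloring[OF fully_colorable_span[OF assms]]
      tpc_le_card_used_colors by fastforce
qed

text \<open>
  The minimum is over a nonempty set, because a single vertex can be grown to the whole graph.
\<close>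
lemma tpc_attained:
  assumes "connected G"
  obtains c where "total_proper_connected G c" "card (used_colors G c) = tpc G"
proof -
  obtain x where x: "x \<in> pverts G" using assms by (auto simp: connected_def strongly_connected_def)
  have "fully_colorable G {x} 2"
    by (rule fully_colorable_if_covered[OF pair_graph_axioms, where c = "\<lambda>_. 0"])
      (use x in \<open>auto intro!: exI[of _ "[x]"]\<close>)
  then have "\<exists>k c. total_proper_connected G c \<and> card (used_colors G c) = k"
    using fully_colorable_imp_proper_coloring[OF fully_colorable_span[OF assms]] x by fastforce
  then have "\<exists>c. total_proper_connected G c \<and> card (used_colors G c) = tpc G"
    unfolding tpc_def by (rule LeastI_ex)
  then show thesis using that by blast
qed

lemma tpc_ge:
  assumes "connected G" "\<And>c. total_proper_connected G c \<Longrightarrow> k \<le> card (used_colors G c)"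
  shows "k \<le> tpc G"
  using tpc_attained[OF assms(1)] assms(2) by metis

end

section \<open>Lower bounds\<close>

context pair_graph
begin

lemma path_of_total_proper:
  assumes "total_proper_path G c p"
  shows "p \<noteq> []" "distinct p" "\<And>i. Suc i < length p \<Longrightarrow> (p ! i, p ! Suc i) \<in> parcs G"
proof -
  have p: "vpath p (with_proj G)" using assms by (simp add: total_proper_path_def)
  then show "p \<noteq> []" "distinct p" by (auto simp: vpath_def vwalk_def)
  have "set (vwalk_arcs p) \<subseteq> parcs G" using p by (auto simp: vpath_def vwalk_def)
  then show "(p ! i, p ! Suc i) \<in> parcs G" if "Suc i < length p" for i
    using that
  proof (induction p arbitrary: i rule: induct_list012)
    case (3 x y p)
    then show ?case by (cases i) auto
  qed auto
qed

lemma total_proper_path_internal: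
  assumes "total_proper_path G c (x # y # z # p)"
  shows "c (Inr {x, y}) \<noteq> c (Inr {y, z})" "c (Inl y) \<noteq> c (Inr {x, y})" "c (Inl y) \<noteq> c (Inr {y, z})"
  using assms unfolding total_proper_path_def by (auto dest!: spec[of _ 0])

lemma vertex_color_used: "x \<in> pverts G \<Longrightarrow> c (Inl x) \<in> used_colors G c"
  unfolding used_colors_def by auto

lemma edge_color_used: "(x, y) \<in> parcs G \<Longrightarrow> c (Inr {x, y}) \<in> used_colors G c"
  unfolding used_colors_def uedges_def by auto

lemma finite_used_colors: "finite (used_colors G c)"
proof -
  have "uedges G = (\<lambda>(u, v). {u, v}) ` parcs G" unfolding uedges_def by auto
  then show ?thesis unfolding used_colors_def using pair_finite_arcs pair_finite_verts by simp
qed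

lemma tpc_ge_3_if_nonadjacent:
  assumes "connected G" "u \<in> pverts G" "v \<in> pverts G" "u \<noteq> v" "(u, v) \<notin> parcs G"
  shows "3 \<le> tpc G"
proof (rule tpc_ge[OF assms(1)])
  fix c assume "total_proper_connected G c"
  then obtain p where p: "total_proper_path G c p" "hd p = u" "last p = v"
    using assms unfolding total_proper_connected_def by blast
  note path = path_of_total_proper[OF p(1)]
  obtain y z q where q: "p = u # y # z # q"
  proof (cases p)
    case (Cons a r)
    moreover have "r \<noteq> []" using Cons p assms(4) by auto
    ultimately obtain b s where r: "p = a # b # s" by (cases r) auto
    have "s \<noteq> []" using r p assms(5) path(3)[of 0] by auto
    then show thesis using that r p(2) by (cases s) auto
  qed (use path in simp)
  have adj: "(u, y) \<in> parcs G" "(y, z) \<in> parcs G" using path(3)[of 0] path(3)[of 1] q by auto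
  have int: "c (Inr {u, y}) \<noteq> c (Inr {y, z})" "c (Inl y) \<noteq> c (Inr {u, y})" "c (Inl y) \<noteq> c (Inr {y, z})"
    using total_proper_path_internal p(1) unfolding q by blast+
  then have "card {c (Inr {u, y}), c (Inr {y, z}), c (Inl y)} = 3" by auto
  moreover have "{c (Inr {u, y}), c (Inr {y, z}), c (Inl y)} \<subseteq> used_colors G c"
    using adj edge_color_used vertex_color_used in_arcsD1 by auto
  ultimately show "3 \<le> card (used_colors G c)" using card_mono[OF finite_used_colors] by metis
qed

lemma tpc_complete:
  assumes "\<And>u v. u \<in> pverts G \<Longrightarrow> v \<in> pverts G \<Longrightarrow> u \<noteq> v \<Longrightarrow> (u, v) \<in> parcs G"
  shows "tpc G \<le> 1"
proof -
  have "total_proper_connected G (\<lambda>_. 0)"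
    unfolding total_proper_connected_def
  proof (intro ballI impI)
    fix u v assume uv: "u \<in> pverts G" "v \<in> pverts G" "u \<noteq> v"
    have "total_proper_path G (\<lambda>_. 0) [u, v]"
      using assms uv by (auto simp: total_proper_path_def vpath_def vwalk_def)
    then show "\<exists>p. total_proper_path G (\<lambda>_. 0) p \<and> hd p = u \<and> last p = v"
      by (intro exI[of _ "[u, v]"]) simp
  qed
  from tpc_le_card_used_colors[OF this] show ?thesis
    using used_colors_bounded[of "\<lambda>_. 0" 1] by simp
qed

text \<open>
  A path between two neighbors of \<open>x\<close> cannot pass through a leaf. Since all neighbors of \<open>x\<close> except
  possibly \<open>b\<close> are leaves, a detour would have to use \<open>x\<close> twice.
\<close>
lemma path_between_neighbors:
  assumes "distinct p" and adj: "\<And>i. Suc i < length p \<Longrightarrow> (p ! i, p ! Suc i) \<in> parcs G"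
    and "p \<noteq> []" "hd p = y" "last p = z" "y \<noteq> z"
    and N: "N = {y. (x, y) \<in> parcs G}" "y \<in> N" "z \<in> N"
    and leaf: "\<And>y t. y \<in> N \<Longrightarrow> y \<noteq> b \<Longrightarrow> (y, t) \<in> parcs G \<Longrightarrow> t = x"
    and "y \<noteq> b"
  shows "\<exists>q. p = y # x # z # q"
proof -
  obtain w q where p: "p = y # w # q"
    using assms(3-6) by (cases p; cases "tl p") auto
  have w: "w = x" using adj[of 0] leaf N(2) \<open>y \<noteq> b\<close> p by auto
  have "x \<noteq> z" using N(1,3) no_loops' by blast
  then obtain v r where q: "q = v # r" using p w \<open>last p = z\<close> by (cases q) auto
  have "v \<in> N" using adj[of 1] p q w N(1) by simp
  have "v = z"
  proof (rule ccontr)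
    assume "v \<noteq> z"
    then have "r \<noteq> []" using p q \<open>last p = z\<close> by auto
    \<comment> \<open>If \<open>v\<close> is a leaf, the path must return to \<open>x\<close> right after it; if \<open>v = b\<close>, then \<open>z\<close> is a leaf, and the
      path must return to \<open>x\<close> right before its end. Both repeat a vertex.\<close>
    show False
    proof (cases "v = b")
      case False
      have "(v, hd r) \<in> parcs G" using adj[of 2] p q \<open>r \<noteq> []\<close> by (cases r) auto
      then have "hd r = x" using leaf \<open>v \<in> N\<close> False by blast
      then show False using \<open>distinct p\<close> p q w \<open>r \<noteq> []\<close> by (cases r) auto
    next
      case True
      have "z \<noteq> b" using True \<open>v \<noteq> z\<close> by simp
      define i where "i = length r"
      have "(p ! (i + 1), p ! (i + 2)) \<in> parcs G" using adj[of "i + 1"] p q by (simp add: i_def)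
      moreover have "p ! (i + 2) = z"
        using \<open>last p = z\<close> p q last_conv_nth[of p] by (simp add: i_def)
      moreover have "p ! (i + 1) \<in> set (v # r)"
        using p q \<open>r \<noteq> []\<close> nth_mem[of "i - 1" "v # r"] by (cases i) (auto simp: i_def nth_Cons')
      ultimately have "x \<in> set (v # r)" using leaf[OF N(3) \<open>z \<noteq> b\<close>] arcs_symmetric by metis
      then show False using \<open>distinct p\<close> p q w by auto
    qed
  qed
  then show ?thesis using p q w by blast
qed

text \<open>
  Paths between neighbors of \<open>x\<close> run through \<open>x\<close> directly, so the edges at \<open>x\<close> have pairwise distinct
  colors, and \<open>x\<close>, being internal on these paths, has yet another one.
\<close>
lemma tpc_ge_degree:
  assumes conn: "connected G"
    and N: "N = {y. (x, y) \<in> parcs G}" and two: "2 \<le> card N"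
    and leaf: "\<And>y t. y \<in> N \<Longrightarrow> y \<noteq> b \<Longrightarrow> (y, t) \<in> parcs G \<Longrightarrow> t = x"
  shows "card N + 1 \<le> tpc G"
proof (rule tpc_ge[OF conn])
  fix c assume c: "total_proper_connected G c"
  have colors: "c (Inr {x, y}) \<noteq> c (Inr {x, z}) \<and> c (Inl x) \<noteq> c (Inr {x, y}) \<and> c (Inl x) \<noteq> c (Inr {x, z})"
    if y: "y \<in> N" and z: "z \<in> N" and "y \<noteq> z" "y \<noteq> b" for y z
  proof -
    have "y \<in> pverts G" "z \<in> pverts G" using y z N in_arcsD2 by auto
    then obtain p where p: "total_proper_path G c p" "hd p = y" "last p = z"
      using c \<open>y \<noteq> z\<close> unfolding total_proper_connected_def by blast
    note path = path_of_total_proper[OF p(1)]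
    obtain q where "p = y # x # z # q"
      using path_between_neighbors[OF path(2) path(3) path(1) p(2,3) \<open>y \<noteq> z\<close> N y z, of b]
        leaf \<open>y \<noteq> b\<close> by blast
    then show ?thesis using total_proper_path_internal[of c y x z q] p(1) by (auto simp: insert_commute)
  qed
  have "finite N" using two by (metis card.infinite not_numeral_le_zero)
  have other: "\<exists>z \<in> N. z \<noteq> y" for y
  proof (rule ccontr)
    assume "\<not> ?thesis"
    then have "N \<subseteq> {y}" by auto
    then show False using two card_mono[of "{y}" N] by simp
  qed
  have inj: "inj_on (\<lambda>y. c (Inr {x, y})) N"
  proof (rule inj_onI)
    fix y z assume yz: "y \<in> N" "z \<in> N" "c (Inr {x, y}) = c (Inr {x, z})"
    show "y = z" using colors[OF yz(1,2)] colors[OF yz(2,1)] yz(3) by (cases "y = b") auto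
  qed
  have notin: "c (Inl x) \<notin> (\<lambda>y. c (Inr {x, y})) ` N"
  proof clarsimp
    fix y assume y: "y \<in> N" "c (Inl x) = c (Inr {x, y})"
    obtain z where "z \<in> N" "z \<noteq> y" using other by blast
    then show False using colors[OF y(1), of z] colors[of z, OF _ y(1)] y by (cases "y = b") auto
  qed
  have "x \<in> pverts G" using other N in_arcsD1 by blast
  then have "insert (c (Inl x)) ((\<lambda>y. c (Inr {x, y})) ` N) \<subseteq> used_colors G c"
    using N edge_color_used vertex_color_used by auto
  from card_mono[OF finite_used_colors this] show "card N + 1 \<le> card (used_colors G c)"
    using notin card_image[OF inj] \<open>finite N\<close> by simp
qed

end

section \<open>Seeds and upper bounds\<close>

context pair_graph
begin

text \<open>
  Along the path, vertices and edges are colored \<open>0, 1, 2, 0, 1, 2, 0\<close> in turn.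
\<close>
lemma fully_colorable_path4:
  assumes "distinct [a, b, c, d]" "(a, b) \<in> parcs G" "(b, c) \<in> parcs G" "(c, d) \<in> parcs G"
  shows "fully_colorable G {a, b, c, d} 3"
proof -
  let ?c = "(\<lambda>_. 0 :: nat)(Inl a := 0, Inr {a, b} := 1, Inl b := 2, Inr {b, c} := 0,
    Inl c := 1, Inr {c, d} := 2, Inl d := 0)"
  have "fully_proper G ?c [a, b, c, d]"
    using assms by (simp add: doubleton_eq_iff in_arcsD2)
  then show ?thesis
    by (intro fully_colorable_if_covered[OF pair_graph_axioms, where c = ?c] exI[of _ "[a, b, c, d]"])
      (auto simp del: fully_proper.simps)
qed

lemma fully_colorable_path5:
  assumes "distinct [a, b, c, d, e]"
    and "(a, b) \<in> parcs G" "(b, c) \<in> parcs G" "(c, d) \<in> parcs G" "(d, e) \<in> parcs G"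
  shows "fully_colorable G {a, b, c, d, e} 3"
proof -
  let ?c = "(\<lambda>_. 0 :: nat)(Inl a := 0, Inr {a, b} := 1, Inl b := 2, Inr {b, c} := 0,
    Inl c := 1, Inr {c, d} := 2, Inl d := 0, Inr {d, e} := 1, Inl e := 2)"
  have "fully_proper G ?c [a, b, c, d, e]"
    using assms by (simp add: doubleton_eq_iff in_arcsD2)
  then show ?thesis
    by (intro fully_colorable_if_covered[OF pair_graph_axioms, where c = ?c] exI[of _ "[a, b, c, d, e]"])
      (auto simp del: fully_proper.simps)
qed

lemma fully_colorable_if_covered_by:
  assumes "W \<noteq> {}" "\<And>s. c s < k" "\<And>p. p \<in> P \<Longrightarrow> fully_proper G c p" "\<And>p. p \<in> P \<Longrightarrow> set p \<subseteq> W"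
    and "\<And>u v. u \<in> W \<Longrightarrow> v \<in> W \<Longrightarrow> \<exists>p \<in> P. u \<in> set p \<and> v \<in> set p"
  shows "fully_colorable G W k"
proof (rule fully_colorable_if_covered[OF pair_graph_axioms assms(1), where c = c])
  fix u v assume "u \<in> W" "v \<in> W"
  then obtain p where "p \<in> P" "u \<in> set p" "v \<in> set p" using assms(5) by blast
  then show "\<exists>p. fully_proper G c p \<and> set p \<subseteq> W \<and> u \<in> set p \<and> v \<in> set p"
    using assms(3,4) by (intro exI[of _ p]) simp
qed (rule assms(2))

text \<open>
  Edges \<open>ax\<close> and \<open>xy\<close> share a color, as do \<open>bx\<close> and \<open>xz\<close>. The four edges at \<open>x\<close> thus need only two
  colors: from \<open>a\<close> to \<open>y\<close> one takes the detour over \<open>b\<close>, and from \<open>b\<close> to \<open>z\<close> the detour over \<open>a\<close>.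
\<close>
lemma fully_colorable_cricket:
  assumes "distinct [a, b, x, y, z]"
    and "(a, b) \<in> parcs G" "(a, x) \<in> parcs G" "(b, x) \<in> parcs G" "(x, y) \<in> parcs G" "(x, z) \<in> parcs G"
  shows "fully_colorable G {a, b, x, y, z} 3"
proof (rule fully_colorable_if_covered_by)
  let ?c = "(\<lambda>_. 0 :: nat)(Inl x := 0, Inl a := 2, Inl b := 1, Inl y := 2, Inl z := 1,
    Inr {a, b} := 0, Inr {a, x} := 1, Inr {b, x} := 2, Inr {x, y} := 1, Inr {x, z} := 2)"
  let ?P = "{[a, b, x, y], [b, a, x, z], [y, x, z]}"
  show "?c s < 3" for s by simp
  have "distinct [z, y, x, b, a]" using assms(1) by auto
  then have "\<forall>p \<in> ?P. fully_proper G ?c p"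
    using assms by (simp add: doubleton_eq_iff in_arcsD2 arcs_symmetric)
  then show "p \<in> ?P \<Longrightarrow> fully_proper G ?c p" for p by blast
qed auto

text \<open>
  The leaf edges at \<open>a\<close> and at \<open>b\<close> can share the color \<open>3\<close>, and the remaining one at each center reuses
  the color of the other center.
\<close>
lemma fully_colorable_double_star33:
  assumes "distinct [p, q, a, b, r, s]"
    and "(a, b) \<in> parcs G" "(a, p) \<in> parcs G" "(a, q) \<in> parcs G" "(b, r) \<in> parcs G" "(b, s) \<in> parcs G"
  shows "fully_colorable G {p, q, a, b, r, s} 4"
proof (rule fully_colorable_if_covered_by)
  let ?c = "(\<lambda>_. 0 :: nat)(Inr {a, b} := 0, Inl a := 1, Inl b := 2, Inr {a, p} := 2, Inr {a, q} := 3,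
    Inr {b, r} := 1, Inr {b, s} := 3)"
  let ?P = "{[p, a, b, r], [p, a, b, s], [q, a, b, r], [q, a, b, s], [p, a, q], [r, b, s]}"
  show "?c s < 4" for s by simp
  have "distinct [s, r, b, a, q, p]" using assms(1) by auto
  then have "\<forall>p \<in> ?P. fully_proper G ?c p"
    using assms by (simp add: doubleton_eq_iff in_arcsD2 arcs_symmetric)
  then show "p \<in> ?P \<Longrightarrow> fully_proper G ?c p" for p by blast
qed auto

lemma tpc_le_path4:
  assumes "connected G" "distinct [a, b, c, d]"
    and "(a, b) \<in> parcs G" "(b, c) \<in> parcs G" "(c, d) \<in> parcs G"
  shows "tpc G \<le> card (pverts G) - 1"
proof -
  have sub: "{a, b, c, d} \<subseteq> pverts G" using assms in_arcsD1 in_arcsD2 by auto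
  moreover have "card {a, b, c, d} = 4" using assms(2) by auto
  ultimately show ?thesis
    using tpc_le_of_seed[OF assms(1) fully_colorable_path4[OF assms(2-5)] _ sub]
      card_mono[OF pair_finite_verts sub] by simp
qed

lemma tpc_le_path5:
  assumes "connected G" "distinct [a, b, c, d, e]"
    and "(a, b) \<in> parcs G" "(b, c) \<in> parcs G" "(c, d) \<in> parcs G" "(d, e) \<in> parcs G"
  shows "tpc G \<le> card (pverts G) - 2"
proof -
  have sub: "{a, b, c, d, e} \<subseteq> pverts G" using assms in_arcsD1 in_arcsD2 by auto
  moreover have "card {a, b, c, d, e} = 5" using assms(2) by auto
  ultimately show ?thesis
    using tpc_le_of_seed[OF assms(1) fully_colorable_path5[OF assms(2-6)] _ sub]
      card_mono[OF pair_finite_verts sub] by simp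
qed

lemma tpc_le_cricket:
  assumes "connected G" "distinct [a, b, x, y, z]"
    and "(a, b) \<in> parcs G" "(a, x) \<in> parcs G" "(b, x) \<in> parcs G" "(x, y) \<in> parcs G" "(x, z) \<in> parcs G"
  shows "tpc G \<le> card (pverts G) - 2"
proof -
  have sub: "{a, b, x, y, z} \<subseteq> pverts G" using assms in_arcsD1 in_arcsD2 by auto
  moreover have "card {a, b, x, y, z} = 5" using assms(2) by auto
  ultimately show ?thesis
    using tpc_le_of_seed[OF assms(1) fully_colorable_cricket[OF assms(2-7)] _ sub]
      card_mono[OF pair_finite_verts sub] by simp
qed

lemma tpc_le_double_star33:
  assumes "connected G" "distinct [p, q, a, b, r, s]"
    and "(a, b) \<in> parcs G" "(a, p) \<in> parcs G" "(a, q) \<in> parcs G" "(b, r) \<in> parcs G" "(b, s) \<in> parcs G"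
  shows "tpc G \<le> card (pverts G) - 2"
proof -
  have sub: "{p, q, a, b, r, s} \<subseteq> pverts G" using assms in_arcsD1 in_arcsD2 by auto
  moreover have "card {p, q, a, b, r, s} = 6" using assms(2) by auto
  ultimately show ?thesis
    using tpc_le_of_seed[OF assms(1) fully_colorable_double_star33[OF assms(2-7)] _ sub]
      card_mono[OF pair_finite_verts sub] by simp
qed

end

section \<open>Connected graphs without a color-saving seed\<close>

context pair_graph
begin

text \<open>
  With no path on four vertices, a fourth vertex can only be attached to the middle of a path on
  three vertices. The middle vertex thus has three neighbors, and an edge from a neighbor to a vertex
  other than the center could be prolonged through the center to a third neighbor.
\<close>
lemma star_if_no_path4:
  assumes "connected G" "4 \<le> card (pverts G)"
    and no_path: "\<And>a b c d. distinct [a, b, c, d] \<Longrightarrow> (a, b) \<in> parcs G \<Longrightarrow> (b, c) \<in> parcs G \<Longrightarrow>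
      (c, d) \<in> parcs G \<Longrightarrow> False"
  obtains x where "x \<in> pverts G" "{y. (x, y) \<in> parcs G} = pverts G - {x}"
    "\<And>y t. (x, y) \<in> parcs G \<Longrightarrow> (y, t) \<in> parcs G \<Longrightarrow> t = x"
proof -
  have small: "W \<subset> pverts G" if "W \<subseteq> pverts G" "card W < 4" for W
    using that assms(2) by (auto simp: psubset_eq)
  obtain u where u: "u \<in> pverts G" using assms(2) by (metis card.empty ex_in_conv not_numeral_le_zero)
  obtain u' v where v: "u' \<in> {u}" "v \<in> pverts G - {u}" "(v, u') \<in> parcs G"
    by (rule crossing_arc[OF assms(1) small[of "{u}"]]) (use u in auto)
  obtain t w where w: "t \<in> {u, v}" "w \<in> pverts G - {u, v}" "(w, t) \<in> parcs G"
    by (rule crossing_arc[OF assms(1) small[of "{u, v}"]]) (use u v in \<open>auto simp: card_insert_if\<close>)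
  obtain x y z where P: "distinct [x, y, z]" "(x, y) \<in> parcs G" "(x, z) \<in> parcs G"
  proof (cases "t = u")
    case True
    then show thesis using that[of u v w] v w by (auto simp: arcs_symmetric)
  next
    case False
    then show thesis using that[of v u w] v w by (auto simp: arcs_symmetric)
  qed
  have "{x, y, z} \<subseteq> pverts G" using P in_arcsD1 in_arcsD2 by auto
  then have "{x, y, z} \<subset> pverts G" by (rule small) (simp add: card_insert_if)
  then obtain r s where s: "r \<in> {x, y, z}" "s \<in> pverts G - {x, y, z}" "(s, r) \<in> parcs G"
    by (rule crossing_arc[OF assms(1)]) auto
  have xs: "(x, s) \<in> parcs G"
    using s no_path[of s y x z] no_path[of s z x y] P by (auto simp: arcs_symmetric)
  have leaf: "t = x" if yt: "(x, y') \<in> parcs G" "(y', t) \<in> parcs G" for y' t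
  proof (rule ccontr)
    assume "t \<noteq> x"
    have "card {y', t} < card {y, z, s}" using P(1) s(2) by (auto simp: card_insert_if)
    then have "\<not> {y, z, s} \<subseteq> {y', t}" by (meson card_mono finite.emptyI finite_insert not_le)
    then obtain r where "r \<in> {y, z, s}" "r \<noteq> y'" "r \<noteq> t" by blast
    then have "(x, r) \<in> parcs G" using P xs by auto
    with \<open>r \<noteq> y'\<close> \<open>r \<noteq> t\<close> \<open>t \<noteq> x\<close> show False
      using no_path[of r x y' t] yt no_loops' by (auto simp: arcs_symmetric)
  qed
  have x: "x \<in> pverts G" using P in_arcsD1 by blast
  have "insert x {y. (x, y) \<in> parcs G} = pverts G"
  proof (rule ccontr)
    assume "\<not> ?thesis"
    then have "insert x {y. (x, y) \<in> parcs G} \<subset> pverts G" using x in_arcsD2 by auto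
    then obtain u v where "u \<in> insert x {y. (x, y) \<in> parcs G}" "(v, u) \<in> parcs G"
      "v \<in> pverts G - insert x {y. (x, y) \<in> parcs G}"
      by (rule crossing_arc[OF assms(1)]) auto
    then show False using leaf[of u v] arcs_symmetric by auto
  qed
  then have "{y. (x, y) \<in> parcs G} = pverts G - {x}" using no_loops' by blast
  then show thesis using that leaf x by blast
qed

text \<open>
  The double star \<open>T(2, \<bar>D\<bar> + 1)\<close> with centers \<open>b\<close> and \<open>c\<close>, where \<open>a\<close> is the leaf at \<open>b\<close> and \<open>D\<close> is the set
  of leaves at \<open>c\<close>.
\<close>
definition is_broom :: "'a \<Rightarrow> 'a \<Rightarrow> 'a \<Rightarrow> 'a set \<Rightarrow> bool" where
  "is_broom a b c D \<longleftrightarrow> distinct [a, b, c] \<and> {a, b, c} \<inter> D = {} \<and> pverts G = {a, b, c} \<union> D \<and>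
     (\<forall>t. (a, t) \<in> parcs G \<longleftrightarrow> t = b) \<and> (\<forall>t. (b, t) \<in> parcs G \<longleftrightarrow> t = a \<or> t = c) \<and>
     (\<forall>t. (c, t) \<in> parcs G \<longleftrightarrow> t = b \<or> t \<in> D) \<and>
     (\<forall>s \<in> D. \<forall>t. (s, t) \<in> parcs G \<longleftrightarrow> t = c)"

text \<open>
  Each further edge produces a forbidden seed. The edge \<open>ac\<close> gives a triangle with the pendant
  edges \<open>cd\<close> and \<open>cw\<close>, a second neighbor of \<open>b\<close> outside the path gives \<open>T(3, 3)\<close>, and every other
  additional edge at \<open>a\<close> or at a leaf of \<open>c\<close> gives a path on five vertices.
\<close>
lemma broom_if_fork:
  assumes conn: "connected G" and large: "card (pverts G) - 2 < tpc G"
    and fork: "distinct [a, b, c, d, w]"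
      "(a, b) \<in> parcs G" "(b, c) \<in> parcs G" "(c, d) \<in> parcs G" "(c, w) \<in> parcs G"
  shows "is_broom a b c ({t. (c, t) \<in> parcs G} - {b})"
proof -
  define D where "D = {t. (c, t) \<in> parcs G} - {b}"
  have no_path: False
    if "distinct [p, q, r, s, t]" "(p, q) \<in> parcs G" "(q, r) \<in> parcs G" "(r, s) \<in> parcs G" "(s, t) \<in> parcs G"
    for p q r s t
    using tpc_le_path5[OF conn that] large by simp
  have rev_arcs: "(b, a) \<in> parcs G" "(c, b) \<in> parcs G" "(d, c) \<in> parcs G" "(w, c) \<in> parcs G"
    using fork by (auto intro: arcs_symmetric)
  have ac: "(a, c) \<notin> parcs G"
    using tpc_le_cricket[OF conn, of a b c d w] large fork by auto
  have dw: "d \<in> D" "w \<in> D" using fork by (auto simp: D_def)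
  have Dne: "s \<noteq> a \<and> s \<noteq> b \<and> s \<noteq> c \<and> (c, s) \<in> parcs G \<and> (s, c) \<in> parcs G" if "s \<in> D" for s
    using that ac arcs_symmetric[of c s] no_loops' unfolding D_def by blast
  have leaf: "t = c" if s: "s \<in> D" "(s, t) \<in> parcs G" for s t
  proof (rule ccontr)
    assume "t \<noteq> c"
    have "s \<noteq> t" using s no_loops' by blast
    obtain s' where s': "s' \<in> D" "s' \<noteq> s" using dw fork(1) by (cases "s = d") auto
    note D = Dne[OF s(1)] Dne[OF s'(1)]
    have ts: "(t, s) \<in> parcs G" using s(2) by (rule arcs_symmetric)
    consider "t = a" | "t = b" | "t \<noteq> a" "t \<noteq> b" by blast
    then show False
    proof cases
      case 1
      then show False using no_path[of s' c s a b] D s s' fork by auto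
    next
      case 2
      then show False using no_path[of a b s c s'] D s' ts fork by auto
    next
      case 3
      then show False using no_path[of a b c s t] D s \<open>s \<noteq> t\<close> \<open>t \<noteq> c\<close> fork by auto
    qed
  qed
  have a: "t = b" if ta0: "(a, t) \<in> parcs G" for t
  proof (rule ccontr)
    assume "t \<noteq> b"
    have ta: "(t, a) \<in> parcs G" using ta0 by (rule arcs_symmetric)
    have "t \<noteq> c" "t \<noteq> a" using ta0 ac no_loops' by auto
    moreover have "t \<notin> D" using leaf[of t a] ta fork(1) by auto
    then have "t \<noteq> d" using dw by auto
    ultimately show False using no_path[of t a b c d] ta fork \<open>t \<noteq> b\<close> by auto
  qed
  have b: "t = a \<or> t = c" if bt: "(b, t) \<in> parcs G" for t
  proof (rule ccontr)
    assume *: "\<not> ?thesis"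
    have "t \<noteq> b" using bt no_loops' by auto
    have "t \<notin> D" using leaf[of t b] arcs_symmetric[OF bt] fork(1) by auto
    then have "distinct [a, t, b, c, d, w]" using dw * \<open>t \<noteq> b\<close> fork(1) by auto
    then show False using tpc_le_double_star33[OF conn, of a t b c d w] large bt fork rev_arcs by simp
  qed
  have V: "{a, b, c} \<union> D = pverts G"
  proof (rule ccontr)
    assume "\<not> ?thesis"
    moreover have "{a, b, c} \<union> D \<subseteq> pverts G"
      using in_arcsD1 in_arcsD2 fork unfolding D_def by blast
    ultimately have "{a, b, c} \<union> D \<subset> pverts G" by blast
    then obtain u v where uv: "u \<in> {a, b, c} \<union> D" "v \<in> pverts G - ({a, b, c} \<union> D)" "(v, u) \<in> parcs G"
      by (rule crossing_arc[OF conn]) auto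
    have "(u, v) \<in> parcs G" using uv(3) by (rule arcs_symmetric)
    then show False using a[of v] b[of v] leaf[of u v] uv(1,2) unfolding D_def by blast
  qed
  show ?thesis
    unfolding is_broom_def D_def[symmetric]
  proof (intro conjI allI ballI)
    show "distinct [a, b, c]" using fork(1) by simp
    show "{a, b, c} \<inter> D = {}" using Dne by blast
    show "pverts G = {a, b, c} \<union> D" using V by simp
    show "(a, t) \<in> parcs G \<longleftrightarrow> t = b" for t using a fork(2) by blast
    show "(b, t) \<in> parcs G \<longleftrightarrow> t = a \<or> t = c" for t using b fork(3) rev_arcs(1) by blast
    show "(c, t) \<in> parcs G \<longleftrightarrow> t = b \<or> t \<in> D" for t using rev_arcs(2) unfolding D_def by blast
    show "(s, t) \<in> parcs G \<longleftrightarrow> t = c" if "s \<in> D" for s t using leaf Dne that by blast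
  qed
qed

text \<open>
  A fifth vertex attached to an end of the path would prolong it to five vertices, so it is attached
  to an inner vertex; up to reversal of the path, this vertex is \<open>c\<close>.
\<close>
lemma broom_if_path4:
  assumes conn: "connected G" and large: "card (pverts G) - 2 < tpc G" and five: "5 \<le> card (pverts G)"
    and path: "distinct [a, b, c, d]" "(a, b) \<in> parcs G" "(b, c) \<in> parcs G" "(c, d) \<in> parcs G"
  shows "\<exists>a b c D. is_broom a b c D"
proof -
  have sub: "{a, b, c, d} \<subseteq> pverts G" using path in_arcsD1 in_arcsD2 by auto
  have "card {a, b, c, d} = 4" using path(1) by auto
  then have "{a, b, c, d} \<subset> pverts G" using five sub by auto
  then obtain u w where w: "u \<in> {a, b, c, d}" "w \<in> pverts G - {a, b, c, d}" "(w, u) \<in> parcs G"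
    by (rule crossing_arc[OF conn]) auto
  have no_path: False
    if "distinct [p, q, r, s, t]" "(p, q) \<in> parcs G" "(q, r) \<in> parcs G" "(r, s) \<in> parcs G" "(s, t) \<in> parcs G"
    for p q r s t
    using tpc_le_path5[OF conn that] large by simp
  have uw: "(u, w) \<in> parcs G" using w(3) by (rule arcs_symmetric)
  have rev_arcs: "(b, a) \<in> parcs G" "(c, b) \<in> parcs G" "(d, c) \<in> parcs G"
    using path by (auto intro: arcs_symmetric)
  have "u \<noteq> a" using no_path[of w a b c d] w path by auto
  moreover have "u \<noteq> d" using no_path[of a b c d w] w(1,2) uw path by auto
  ultimately consider "u = b" | "u = c" using w(1) by blast
  then show ?thesis
  proof cases
    case 1
    then have "is_broom d c b ({t. (b, t) \<in> parcs G} - {c})"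
      by (intro broom_if_fork[OF conn large, of d c b a w]) (use path w uw rev_arcs in auto)
    then show ?thesis by blast
  next
    case 2
    then have "is_broom a b c ({t. (c, t) \<in> parcs G} - {b})"
      by (intro broom_if_fork[OF conn large, of a b c d w]) (use path w uw rev_arcs in auto)
    then show ?thesis by blast
  qed
qed

end

section \<open>Isomorphisms with the extremal graphs\<close>

text \<open>
  For graphs without parallel arcs, the action of an isomorphism on arcs is determined by the vertices.
  The bijection goes from \<open>H\<close> to \<open>G\<close>, so that subgraphs of a concrete graph \<open>H\<close> are found in \<open>G\<close> as images.
\<close>
lemma digraph_iso_iff:
  assumes "pair_graph G" "pair_graph H"
  shows "digraph_iso (with_proj G) (with_proj H) \<longleftrightarrow>
    (\<exists>f. bij_betw f (pverts H) (pverts G) \<and>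
      (\<forall>u \<in> pverts H. \<forall>v \<in> pverts H. (f u, f v) \<in> parcs G \<longleftrightarrow> (u, v) \<in> parcs H))"
    (is "?L \<longleftrightarrow> ?R")
proof
  interpret G: pair_graph G by fact
  interpret H: pair_graph H by fact
  assume ?L
  then obtain h where h: "pre_digraph.digraph_isomorphism (with_proj G) h"
    "with_proj H = app_iso h (with_proj G)"
    unfolding digraph_iso_def by blast
  define g where "g = iso_verts h"
  have inj: "inj_on g (pverts G)"
    using h(1) unfolding pre_digraph.digraph_isomorphism_def g_def by simp
  have V: "pverts H = g ` pverts G" using arg_cong[OF h(2), of verts] by (simp add: g_def)
  have hd: "iso_tail h = fst" "iso_head h = snd"
    using arg_cong[OF h(2), of tail] arg_cong[OF h(2), of head] by simp_all
  have arc: "iso_arcs h (u, v) = (g u, g v)" if "(u, v) \<in> parcs G" for u v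
    using h(1) that hd unfolding pre_digraph.digraph_isomorphism_def g_def
    by (metis fst_conv prod.collapse snd_conv with_proj_simps(2,4,5))
  have A: "parcs H = iso_arcs h ` parcs G" using arg_cong[OF h(2), of arcs] by simp
  have E: "(u, v) \<in> parcs G \<longleftrightarrow> (g u, g v) \<in> parcs H" if uv: "u \<in> pverts G" "v \<in> pverts G" for u v
  proof
    assume "(g u, g v) \<in> parcs H"
    then obtain a b where ab: "(a, b) \<in> parcs G" "(g u, g v) = (g a, g b)"
      using A arc by (metis (no_types, lifting) imageE prod.collapse)
    then have "u = a" "v = b" using uv inj G.in_arcsD1 G.in_arcsD2 by (auto dest: inj_onD)
    then show "(u, v) \<in> parcs G" using ab by simp
  qed (use A arc in force)
  have bij: "bij_betw g (pverts G) (pverts H)" using inj V by (simp add: bij_betw_def)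
  let ?f = "the_inv_into (pverts G) g"
  have "bij_betw ?f (pverts H) (pverts G)" by (rule bij_betw_the_inv_into[OF bij])
  moreover have "(?f (g u), ?f (g v)) \<in> parcs G \<longleftrightarrow> (g u, g v) \<in> parcs H"
    if "u \<in> pverts G" "v \<in> pverts G" for u v
    using E[OF that] that inj by (simp add: the_inv_into_f_f)
  ultimately show ?R unfolding V by (intro exI[of _ ?f]) auto
next
  interpret G: pair_graph G by fact
  interpret H: pair_graph H by fact
  assume ?R
  then obtain f where bij: "bij_betw f (pverts H) (pverts G)"
    and E: "\<And>u v. u \<in> pverts H \<Longrightarrow> v \<in> pverts H \<Longrightarrow> (f u, f v) \<in> parcs G \<longleftrightarrow> (u, v) \<in> parcs H"
    by blast
  define g where "g = the_inv_into (pverts H) f"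
  have gf: "g (f u) = u" if "u \<in> pverts H" for u
    using that bij unfolding g_def bij_betw_def by (simp add: the_inv_into_f_f)
  have bijg: "bij_betw g (pverts G) (pverts H)" unfolding g_def by (rule bij_betw_the_inv_into[OF bij])
  have VG: "pverts G = f ` pverts H" using bij by (simp add: bij_betw_def)
  have A: "parcs H = map_prod g g ` parcs G"
  proof (rule equalityI; rule subrelI)
    fix u v assume uv: "(u, v) \<in> parcs H"
    then have "u \<in> pverts H" "v \<in> pverts H" using H.in_arcsD1 H.in_arcsD2 by auto
    then have "(f u, f v) \<in> parcs G" "map_prod g g (f u, f v) = (u, v)" using uv E gf by auto
    then show "(u, v) \<in> map_prod g g ` parcs G" by (metis image_eqI)
  next
    fix u' v' assume "(u', v') \<in> map_prod g g ` parcs G"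
    then obtain a b where ab: "(a, b) \<in> parcs G" "u' = g a" "v' = g b" by auto
    then obtain u v where "a = f u" "b = f v" "u \<in> pverts H" "v \<in> pverts H"
      using G.in_arcsD1 G.in_arcsD2 VG by blast
    then show "(u', v') \<in> parcs H" using ab E gf by simp
  qed
  let ?h = "\<lparr>iso_verts = g, iso_arcs = map_prod g g, iso_head = snd, iso_tail = fst\<rparr>"
  have "pre_digraph.digraph_isomorphism (with_proj G) ?h"
    unfolding pre_digraph.digraph_isomorphism_def
  proof (intro conjI)
    show "inj_on (iso_arcs ?h) (arcs (with_proj G))"
      using bijg by (auto simp: inj_on_def bij_betw_def map_prod_def dest: G.in_arcsD1 G.in_arcsD2)
  qed (use bijg G.wf_digraph_axioms in \<open>auto simp: bij_betw_def\<close>)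
  moreover have "with_proj H = app_iso ?h (with_proj G)"
    using A bijg by (simp add: app_iso_def with_proj_def bij_betw_def)
  ultimately show ?L unfolding digraph_iso_def by blast
qed

lemma star_graph_arc_iff:
  "(x, y) \<in> parcs (star_graph m) \<longleftrightarrow> x = 0 \<and> 1 \<le> y \<and> y < m \<or> y = 0 \<and> 1 \<le> x \<and> x < m"
  by (auto simp: star_graph_def symcl_def image_iff)

context pair_graph
begin

lemma double_star_iso_if_broom:
  assumes "is_broom a b c D"
  shows "digraph_iso (with_proj G) (with_proj (double_star 2 (card (pverts G) - 2)))"
proof -
  let ?m = "card (pverts G) - 2"
  have V: "pverts G = {a, b, c} \<union> D" and ne: "distinct [a, b, c]" "distinct [c, b, a]" "a \<notin> D" "b \<notin> D" "c \<notin> D"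
    and arcs: "\<And>t. (a, t) \<in> parcs G \<longleftrightarrow> t = b" "\<And>t. (b, t) \<in> parcs G \<longleftrightarrow> t = a \<or> t = c"
      "\<And>t. (c, t) \<in> parcs G \<longleftrightarrow> t = b \<or> t \<in> D"
      "\<And>s t. s \<in> D \<Longrightarrow> (s, t) \<in> parcs G \<longleftrightarrow> t = c"
    using assms unfolding is_broom_def by auto
  have "finite D" using V pair_finite_verts by simp
  have "card ({a, b, c} \<union> D) = card {a, b, c} + card D"
    using ne \<open>finite D\<close> by (intro card_Un_disjoint) auto
  then have "card (pverts G) = 3 + card D" using V ne(1) by auto
  then have m: "?m = Suc (card D)" by simp
  let ?I = "{1..<Suc (card D)}"
  obtain h where h: "bij_betw h ?I D"
    using finite_same_card_bij[of ?I D] \<open>finite D\<close> by auto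
  have hD: "h i \<in> D" "h i \<noteq> a" "h i \<noteq> b" "h i \<noteq> c" if "i \<in> ?I" for i
    using h that ne by (auto simp: bij_betw_def)
  define f where "f = case_sum (\<lambda>i :: nat. if i = 0 then b else a) (\<lambda>i :: nat. if i = 0 then c else h i)"
  have f: "f (Inl 0) = b" "f (Inl (Suc 0)) = a" "f (Inr 0) = c" "\<And>i. i \<in> ?I \<Longrightarrow> f (Inr i) = h i"
    by (auto simp: f_def)
  let ?H = "double_star 2 (Suc (card D))"
  have VH: "pverts ?H = {Inl 0, Inl 1, Inr 0} \<union> Inr ` ?I"
    by (auto simp: double_star_def add_edge_def disjoint_union_def star_graph_def)
  have E: "parcs ?H = {(Inl 0, Inl 1), (Inl 1, Inl 0), (Inl 0, Inr 0), (Inr 0, Inl 0)} \<union>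
      (\<lambda>i. (Inr 0, Inr i)) ` ?I \<union> (\<lambda>i. (Inr i, Inr 0)) ` ?I"
    by (auto simp: double_star_def add_edge_def disjoint_union_def star_graph_arc_iff)
  have "f ` pverts ?H = {b, a, c} \<union> h ` ?I"
    unfolding VH image_Un image_image by (simp add: f)
  then have onto: "f ` pverts ?H = pverts G" using V h by (auto simp: bij_betw_def)
  have "card (pverts ?H) = 3 + card D"
    unfolding VH by (subst card_Un_disjoint) (auto simp: card_image)
  then have "inj_on f (pverts ?H)"
    using onto \<open>card (pverts G) = 3 + card D\<close> VH by (intro eq_card_imp_inj_on) auto
  then have "bij_betw f (pverts ?H) (pverts G)" using onto by (simp add: bij_betw_def)
  moreover have "(f u, f v) \<in> parcs G \<longleftrightarrow> (u, v) \<in> parcs ?H" if u: "u \<in> pverts ?H" and v: "v \<in> pverts ?H" for u v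
  proof -
    have cases: "w = Inl 0 \<or> w = Inl 1 \<or> w = Inr 0 \<or> (\<exists>i \<in> ?I. w = Inr i)" if "w \<in> pverts ?H" for w
      using that unfolding VH by blast
    show ?thesis
      using cases[OF u] cases[OF v]
      by (elim disjE bexE) (use ne in \<open>simp_all add: E f arcs hD image_iff\<close>)
  qed
  ultimately show ?thesis
    unfolding m using digraph_iso_iff[OF pair_graph_axioms pair_graph_double_star[of 2 "Suc (card D)"]]
    by auto
qed

end

lemma parcs_C4: "parcs (cycle_graph 4) = {(0,1),(1,0),(1,2),(2,1),(2,3),(3,2),(3,0),(0,3)}"
proof -
  have four: "i < 4 \<longleftrightarrow> i \<in> {0, 1, 2, 3}" for i :: nat by auto
  have "{(i, (i + 1) mod 4) | i. i < 4} = (\<lambda>i :: nat. (i, (i + 1) mod 4)) ` {0, 1, 2, 3}"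
    unfolding four by blast
  also have "\<dots> = {(0, 1), (1, 2), (2, 3), (3, 0)}" by (simp del: One_nat_def)
  finally have "{(i, (i + 1) mod 4) | i. i < 4} = {(0 :: nat, 1 :: nat), (1, 2), (2, 3), (3, 0)}" .
  then show ?thesis by (auto simp: cycle_graph_def symcl_def)
qed

lemma parcs_C4_plus_e:
  "parcs C4_plus_e = {(0,1),(1,0),(1,2),(2,1),(2,3),(3,2),(3,0),(0,3),(0,2),(2,0)}"
  by (auto simp: C4_plus_e_def add_edge_def parcs_C4)

lemma parcs_S4_plus_e:
  "parcs S4_plus_e = {(0,1),(1,0),(0,2),(2,0),(0,3),(3,0),(1,2),(2,1)}"
proof -
  have "parcs (star_graph 4) = {(0,1),(1,0),(0,2),(2,0),(0,3),(3,0)}"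
    by (auto simp: star_graph_arc_iff)
  then show ?thesis by (auto simp: S4_plus_e_def add_edge_def)
qed

lemma pverts_four:
  "pverts (cycle_graph 4) = {0, 1, 2, 3}" "pverts C4_plus_e = {0, 1, 2, 3}" "pverts S4_plus_e = {0, 1, 2, 3}"
  by (auto simp: cycle_graph_def C4_plus_e_def S4_plus_e_def star_graph_def add_edge_def)

context pair_graph
begin

lemma digraph_iso_four:
  fixes H :: "nat pair_pre_digraph"
  assumes H: "pair_graph H" "pverts H = {0, 1, 2, 3}"
    and V: "pverts G = {a, b, c, d}" "distinct [a, b, c, d]"
    and arcs: "(a, b) \<in> parcs G \<longleftrightarrow> (0, 1) \<in> parcs H" "(a, c) \<in> parcs G \<longleftrightarrow> (0, 2) \<in> parcs H"
      "(a, d) \<in> parcs G \<longleftrightarrow> (0, 3) \<in> parcs H" "(b, c) \<in> parcs G \<longleftrightarrow> (1, 2) \<in> parcs H"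
      "(b, d) \<in> parcs G \<longleftrightarrow> (1, 3) \<in> parcs H" "(c, d) \<in> parcs G \<longleftrightarrow> (2, 3) \<in> parcs H"
  shows "digraph_iso (with_proj G) (with_proj H)"
proof -
  interpret H: pair_graph H by fact
  define f where "f i = [a, b, c, d] ! i" for i
  have f: "f 0 = a" "f 1 = b" "f 2 = c" "f 3 = d" by (simp_all add: f_def)
  have onto: "f ` pverts H = pverts G" unfolding H(2) V(1) using f by simp
  have "inj_on f (pverts H)"
    unfolding H(2) using V(2) f by (auto simp: inj_on_def)
  then have "bij_betw f (pverts H) (pverts G)" using onto by (simp add: bij_betw_def)
  moreover have rev_iff: "(v, u) \<in> parcs G \<longleftrightarrow> (j, i) \<in> parcs H"
    if "(u, v) \<in> parcs G \<longleftrightarrow> (i, j) \<in> parcs H" for u v i j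
    using that arcs_symmetric[of u v] arcs_symmetric[of v u]
      H.arcs_symmetric[of i j] H.arcs_symmetric[of j i] by blast
  have "(u, u) \<notin> parcs G" "(i, i) \<notin> parcs H" for u i using no_loops' H.no_loops' by blast+
  then have "\<forall>u \<in> pverts H. \<forall>v \<in> pverts H. (f u, f v) \<in> parcs G \<longleftrightarrow> (u, v) \<in> parcs H"
    unfolding H(2) using arcs arcs[THEN rev_iff] by (simp add: f del: One_nat_def)
  ultimately show ?thesis using digraph_iso_iff[OF pair_graph_axioms H(1)] by blast
qed

text \<open>
  The possible edges beyond the path are \<open>ac\<close>, \<open>bd\<close> and \<open>ad\<close>. None of them gives \<open>T(2, 2)\<close>, only \<open>ad\<close>
  gives the cycle, one of \<open>ac\<close> and \<open>bd\<close> alone gives \<open>S\<^sub>4 + e\<close>, any two of the three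
  give \<open>C\<^sub>4 + e\<close>, and all three contradict the nonadjacent pair.
\<close>
lemma four_vertices_classification:
  assumes V: "pverts G = {a, b, c, d}" "distinct [a, b, c, d]"
    and path: "(a, b) \<in> parcs G" "(b, c) \<in> parcs G" "(c, d) \<in> parcs G"
    and nonadj: "u \<in> pverts G" "v \<in> pverts G" "u \<noteq> v" "(u, v) \<notin> parcs G"
  shows "digraph_iso (with_proj G) (with_proj (double_star 2 2)) \<or>
    digraph_iso (with_proj G) (with_proj (cycle_graph 4)) \<or>
    digraph_iso (with_proj G) (with_proj C4_plus_e) \<or>
    digraph_iso (with_proj G) (with_proj S4_plus_e)"
proof -
  have sym: "(x, y) \<in> parcs G \<longleftrightarrow> (y, x) \<in> parcs G" for x y using arcs_symmetric by blast
  have rev_arcs: "(b, a) \<in> parcs G" "(c, b) \<in> parcs G" "(d, c) \<in> parcs G"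
    using path by (auto intro: arcs_symmetric)
  have perm: "pverts G = {b, c, d, a}" "pverts G = {b, d, c, a}" "pverts G = {c, a, b, d}"
    "distinct [b, c, d, a]" "distinct [b, d, c, a]" "distinct [c, a, b, d]"
    using V by auto
  note C4 = pair_graph_cycle_graph[of 4, simplified] pverts_four(1)
  note C4e = pair_graph_C4_plus_e pverts_four(2)
  note S4e = pair_graph_S4_plus_e pverts_four(3)
  note parcs = parcs_C4 parcs_C4_plus_e parcs_S4_plus_e
  show ?thesis
  proof (cases "(a, c) \<in> parcs G"; cases "(b, d) \<in> parcs G"; cases "(a, d) \<in> parcs G")
    assume ch: "(a, c) \<notin> parcs G" "(b, d) \<notin> parcs G" "(a, d) \<notin> parcs G"
    have "is_broom a b c {d}"
      unfolding is_broom_def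
    proof (intro conjI allI ballI)
      have in_V: "t \<in> {a, b, c, d}" if "(s, t) \<in> parcs G" for s t
        using in_arcsD2[OF that] V(1) by simp
      have no: "(c, a) \<notin> parcs G" "(d, b) \<notin> parcs G" "(d, a) \<notin> parcs G" "(s, s) \<notin> parcs G" for s
        using ch sym no_loops' by blast+
      show "(a, t) \<in> parcs G \<longleftrightarrow> t = b" for t using in_V[of a t] no path rev_arcs ch by blast
      show "(b, t) \<in> parcs G \<longleftrightarrow> t = a \<or> t = c" for t using in_V[of b t] no path rev_arcs ch by blast
      show "(c, t) \<in> parcs G \<longleftrightarrow> t = b \<or> t \<in> {d}" for t using in_V[of c t] no path rev_arcs ch by blast
      show "(s, t) \<in> parcs G \<longleftrightarrow> t = c" if "s \<in> {d}" for s t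
        using in_V[of d t] no path rev_arcs ch that by blast
    qed (use V in auto)
    moreover have "card {a, b, c, d} = 4" using V(2) by auto
    ultimately show ?thesis using double_star_iso_if_broom V(1) by fastforce
  next
    assume ch: "(a, c) \<notin> parcs G" "(b, d) \<notin> parcs G" "(a, d) \<in> parcs G"
    have "digraph_iso (with_proj G) (with_proj (cycle_graph 4))"
      by (rule digraph_iso_four[OF C4 V]) (use ch path in \<open>simp_all add: parcs\<close>)
    then show ?thesis by blast
  next
    assume ch: "(a, c) \<in> parcs G" "(b, d) \<notin> parcs G" "(a, d) \<notin> parcs G"
    have "digraph_iso (with_proj G) (with_proj S4_plus_e)"
      by (rule digraph_iso_four[OF S4e perm(3,6)])
        (use ch path rev_arcs sym[of c a] in \<open>simp_all add: parcs\<close>)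
    then show ?thesis by blast
  next
    assume ch: "(a, c) \<notin> parcs G" "(b, d) \<in> parcs G" "(a, d) \<notin> parcs G"
    have "digraph_iso (with_proj G) (with_proj S4_plus_e)"
      by (rule digraph_iso_four[OF S4e perm(1,4)])
        (use ch path rev_arcs sym[of c a] sym[of d a] in \<open>simp_all add: parcs\<close>)
    then show ?thesis by blast
  next
    assume ch: "(a, c) \<in> parcs G" "(b, d) \<notin> parcs G" "(a, d) \<in> parcs G"
    have "digraph_iso (with_proj G) (with_proj C4_plus_e)"
      by (rule digraph_iso_four[OF C4e V]) (use ch path in \<open>simp_all add: parcs\<close>)
    then show ?thesis by blast
  next
    assume ch: "(a, c) \<notin> parcs G" "(b, d) \<in> parcs G" "(a, d) \<in> parcs G"
    have "digraph_iso (with_proj G) (with_proj C4_plus_e)"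
      by (rule digraph_iso_four[OF C4e perm(1,4)])
        (use ch path rev_arcs sym[of c a] sym[of d a] in \<open>simp_all add: parcs\<close>)
    then show ?thesis by blast
  next
    assume ch: "(a, c) \<in> parcs G" "(b, d) \<in> parcs G" "(a, d) \<notin> parcs G"
    have "digraph_iso (with_proj G) (with_proj C4_plus_e)"
      by (rule digraph_iso_four[OF C4e perm(2,5)])
        (use ch path rev_arcs sym[of c a] sym[of d a] in \<open>simp_all add: parcs\<close>)
    then show ?thesis by blast
  next
    assume ch: "(a, c) \<in> parcs G" "(b, d) \<in> parcs G" "(a, d) \<in> parcs G"
    have "(c, a) \<in> parcs G" "(d, b) \<in> parcs G" "(d, a) \<in> parcs G" using ch sym by blast+
    then have False using nonadj V ch path rev_arcs by auto
    then show ?thesis ..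
  qed
qed

text \<open>
  On four vertices, a spanning path gives at most three colors, and a nonadjacent pair at least three.
\<close>
lemma tpc_if_iso_four:
  fixes H :: "'b pair_pre_digraph"
  assumes "connected G" "pair_graph H" "digraph_iso (with_proj G) (with_proj H)" "card (pverts H) = 4"
    and path: "distinct [a, b, c, d]" "(a, b) \<in> parcs H" "(b, c) \<in> parcs H" "(c, d) \<in> parcs H"
    and nonadj: "u \<in> pverts H" "v \<in> pverts H" "u \<noteq> v" "(u, v) \<notin> parcs H"
  shows "tpc G = card (pverts G) - 1"
proof -
  interpret H: pair_graph H by fact
  obtain f where f: "bij_betw f (pverts H) (pverts G)"
    "\<And>u v. u \<in> pverts H \<Longrightarrow> v \<in> pverts H \<Longrightarrow> (f u, f v) \<in> parcs G \<longleftrightarrow> (u, v) \<in> parcs H"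
    using assms(3) unfolding digraph_iso_iff[OF pair_graph_axioms assms(2)] by blast
  have inj: "inj_on f (pverts H)" and onto: "f ` pverts H = pverts G"
    using f(1) by (simp_all add: bij_betw_def)
  have four: "card (pverts G) = 4" using assms(4) bij_betw_same_card[OF f(1)] by simp
  have V: "{a, b, c, d} \<subseteq> pverts H" using path H.in_arcsD1 H.in_arcsD2 by blast
  have "distinct (map f [a, b, c, d])"
    using path(1) inj_on_subset[OF inj V] by (subst distinct_map) simp
  then have "distinct [f a, f b, f c, f d]" by simp
  then have "tpc G \<le> card (pverts G) - 1"
    by (rule tpc_le_path4[OF assms(1)]) (use f(2) V path in auto)
  moreover have "3 \<le> tpc G"
    by (rule tpc_ge_3_if_nonadjacent[OF assms(1), of "f u" "f v"])
      (use nonadj f(2) onto inj in \<open>auto dest: inj_onD\<close>)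
  ultimately show ?thesis using four by simp
qed

text \<open>
  The center \<open>Inr 0\<close> of the larger star has degree \<open>n - 2\<close>, and its only neighbor that is not a leaf
  is the other center \<open>Inl 0\<close>.
\<close>
lemma tpc_if_iso_double_star:
  assumes "connected G" "4 \<le> card (pverts G)"
    and "digraph_iso (with_proj G) (with_proj (double_star 2 (card (pverts G) - 2)))"
  shows "tpc G = card (pverts G) - 1"
proof -
  define m where "m = card (pverts G) - 2"
  have m: "2 \<le> m" using assms(2) by (simp add: m_def)
  let ?H = "double_star 2 m"
  have H: "pair_graph ?H" using m by (intro pair_graph_double_star) auto
  interpret H: pair_graph ?H by fact
  obtain f where f: "bij_betw f (pverts ?H) (pverts G)"
    "\<And>u v. u \<in> pverts ?H \<Longrightarrow> v \<in> pverts ?H \<Longrightarrow> (f u, f v) \<in> parcs G \<longleftrightarrow> (u, v) \<in> parcs ?H"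
    using assms(3) unfolding m_def[symmetric] digraph_iso_iff[OF pair_graph_axioms H] by blast
  have inj: "inj_on f (pverts ?H)" and onto: "f ` pverts ?H = pverts G"
    using f(1) by (simp_all add: bij_betw_def)
  have V: "pverts ?H = {Inl 0, Inl 1} \<union> Inr ` {0..<m}"
    by (auto simp: double_star_def add_edge_def disjoint_union_def star_graph_def)
  have arc_Inr0: "(Inr 0, t) \<in> parcs ?H \<longleftrightarrow> t \<in> insert (Inl 0) (Inr ` {1..<m})" for t
    by (cases t) (auto simp: double_star_def add_edge_def disjoint_union_def star_graph_arc_iff)
  have arc_Inr: "(Inr i, t) \<in> parcs ?H \<longleftrightarrow> t = Inr 0" if "i \<in> {1..<m}" for i t
    using that by (cases t) (auto simp: double_star_def add_edge_def disjoint_union_def star_graph_arc_iff)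
  have arc_Inl: "(Inl 1, Inl 0) \<in> parcs ?H" "(Inl 0, Inr 0) \<in> parcs ?H"
    by (auto simp: double_star_def add_edge_def disjoint_union_def star_graph_arc_iff)
  let ?N = "{y. (f (Inr 0), y) \<in> parcs G}"
  have N: "?N = f ` insert (Inl 0) (Inr ` {1..<m})"
  proof (intro set_eqI iffI)
    fix y assume "y \<in> ?N"
    then have y: "(f (Inr 0), y) \<in> parcs G" by simp
    then obtain t where "t \<in> pverts ?H" "y = f t"
      using in_arcsD2[OF y] unfolding onto[symmetric] by blast
    with y show "y \<in> f ` insert (Inl 0) (Inr ` {1..<m})" using f(2)[of "Inr 0" t] arc_Inr0 V m by auto
  next
    fix y assume "y \<in> f ` insert (Inl 0) (Inr ` {1..<m})"
    then obtain t where t: "t \<in> insert (Inl 0) (Inr ` {1..<m})" "y = f t" by blast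
    then have "(Inr 0, t) \<in> parcs ?H" using arc_Inr0 by blast
    then show "y \<in> ?N" using f(2) t H.in_arcsD1 H.in_arcsD2 by blast
  qed
  have sub: "insert (Inl 0) (Inr ` {1..<m}) \<subseteq> pverts ?H" using V by auto
  have "card ?N = card (insert (Inl 0) (Inr ` {1..<m}) :: (nat + nat) set)"
    unfolding N by (rule card_image[OF inj_on_subset[OF inj sub]])
  also have "\<dots> = m" using m by (subst card_insert_disjoint) (auto simp: card_image)
  finally have card_N: "card ?N = m" .
  have "card ?N + 1 \<le> tpc G"
  proof (rule tpc_ge_degree[OF assms(1) refl, where b = "f (Inl 0)"])
    fix y t assume y: "y \<in> ?N" "y \<noteq> f (Inl 0)" "(y, t) \<in> parcs G"
    then obtain i where i: "i \<in> {1..<m}" "y = f (Inr i)" unfolding N by auto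
    obtain s where s: "s \<in> pverts ?H" "t = f s" using in_arcsD2[OF y(3)] unfolding onto[symmetric] by blast
    then have "(Inr i, s) \<in> parcs ?H" using f(2)[of "Inr i" s] y(3) i V by auto
    then have "s = Inr 0" using arc_Inr[OF i(1)] by simp
    then show "t = f (Inr 0)" using s(2) by simp
  qed (use m card_N in simp)
  then have "card (pverts G) - 1 \<le> tpc G" using card_N assms(2) by (simp add: m_def)
  moreover have "tpc G \<le> card (pverts G) - 1"
  proof (rule tpc_le_path4[OF assms(1)])
    have V4: "{Inl 1, Inl 0, Inr 0, Inr 1} \<subseteq> pverts ?H" using V m by auto
    have "distinct (map f [Inl 1, Inl 0, Inr 0, Inr 1])"
      using inj_on_subset[OF inj V4] by (subst distinct_map) simp
    then show "distinct [f (Inl 1), f (Inl 0), f (Inr 0), f (Inr 1)]" by simp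
    have "(Inr 0, Inr 1) \<in> parcs ?H" using arc_Inr0 m by auto
    then show "(f (Inl 1), f (Inl 0)) \<in> parcs G" "(f (Inl 0), f (Inr 0)) \<in> parcs G"
      "(f (Inr 0), f (Inr 1)) \<in> parcs G"
      using f(2) V4 arc_Inl by auto
  qed
  ultimately show ?thesis by simp
qed

end

section \<open>The characterization\<close>

theorem theorem4:
  fixes G :: "'a pair_pre_digraph" and n :: nat
  assumes "pair_graph G"
    and "Digraph_Component.connected (with_proj G)"
    and "card (pverts G) = n"
    and "n \<ge> 3"
  shows "tpc G = n - 1 \<longleftrightarrow>
    (n \<ge> 4 \<and> digraph_iso (with_proj G) (with_proj (double_star 2 (n - 2)))) \<or>
    digraph_iso (with_proj G) (with_proj (cycle_graph 4)) \<or>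
    digraph_iso (with_proj G) (with_proj C4_plus_e) \<or>
    digraph_iso (with_proj G) (with_proj S4_plus_e)"
    (is "_ \<longleftrightarrow> ?iso")
proof
  interpret pair_graph G by fact
  assume tpc: "tpc G = n - 1"
  note conn = assms(2)
  obtain u v where nonadj: "u \<in> pverts G" "v \<in> pverts G" "u \<noteq> v" "(u, v) \<notin> parcs G"
    using tpc_complete tpc assms(4) by fastforce
  then have "3 \<le> tpc G" using tpc_ge_3_if_nonadjacent[OF conn] by blast
  then have n: "4 \<le> n" using tpc by simp
  have "\<exists>a b c d. distinct [a, b, c, d] \<and> (a, b) \<in> parcs G \<and> (b, c) \<in> parcs G \<and> (c, d) \<in> parcs G"
  proof (rule ccontr)
    assume no_path: "\<not> ?thesis"
    obtain x where x: "x \<in> pverts G" "{y. (x, y) \<in> parcs G} = pverts G - {x}"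
      and leaf: "\<And>y t. (x, y) \<in> parcs G \<Longrightarrow> (y, t) \<in> parcs G \<Longrightarrow> t = x"
      using star_if_no_path4[OF conn] n assms(3) no_path by metis
    have card: "card {y. (x, y) \<in> parcs G} = n - 1" using x assms(3) pair_finite_verts by simp
    \<comment> \<open>All neighbors are leaves, so any non-neighbor can stand for the exceptional one.\<close>
    have "card {y. (x, y) \<in> parcs G} + 1 \<le> tpc G"
      by (rule tpc_ge_degree[OF conn refl, where b = x]) (use card n leaf in auto)
    then show False using card tpc n by simp
  qed
  then obtain a b c d where path: "distinct [a, b, c, d]"
    "(a, b) \<in> parcs G" "(b, c) \<in> parcs G" "(c, d) \<in> parcs G" by blast
  show ?iso
  proof (cases "n = 4")
    case True
    have "{a, b, c, d} \<subseteq> pverts G" using path in_arcsD1 in_arcsD2 by blast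
    moreover have "card {a, b, c, d} = 4" using path(1) by auto
    ultimately have "pverts G = {a, b, c, d}"
      using card_subset_eq[OF pair_finite_verts] assms(3) True by metis
    from four_vertices_classification[OF this path nonadj] show ?thesis using True by simp
  next
    case False
    have "card (pverts G) - 2 < tpc G" "5 \<le> card (pverts G)" using False tpc n assms(3) by linarith+
    from broom_if_path4[OF conn this path] obtain a b c D where "is_broom a b c D" by blast
    from double_star_iso_if_broom[OF this] show ?thesis using n assms(3) by simp
  qed
next
  interpret pair_graph G by fact
  note conn = assms(2)
  have card4: "card {0, 1, 2, 3 :: nat} = 4" by simp
  assume ?iso
  then consider "4 \<le> n" "digraph_iso (with_proj G) (with_proj (double_star 2 (n - 2)))"
    | "digraph_iso (with_proj G) (with_proj (cycle_graph 4))"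
    | "digraph_iso (with_proj G) (with_proj C4_plus_e)"
    | "digraph_iso (with_proj G) (with_proj S4_plus_e)" by blast
  then show "tpc G = n - 1"
  proof cases
    case 1
    then show ?thesis using tpc_if_iso_double_star[OF conn] assms(3) by simp
  next
    case 2
    have "tpc G = card (pverts G) - 1"
      by (rule tpc_if_iso_four[OF conn pair_graph_cycle_graph 2, of 0 1 2 3 0 2])
        (simp_all add: pverts_four parcs_C4)
    then show ?thesis using assms(3) by simp
  next
    case 3
    have "tpc G = card (pverts G) - 1"
      by (rule tpc_if_iso_four[OF conn pair_graph_C4_plus_e 3, of 0 1 2 3 1 3])
        (simp_all add: pverts_four parcs_C4_plus_e)
    then show ?thesis using assms(3) by simp
  next
    case 4
    have "tpc G = card (pverts G) - 1"
      by (rule tpc_if_iso_four[OF conn pair_graph_S4_plus_e 4, of 3 0 1 2 1 3])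
        (simp_all add: pverts_four parcs_S4_plus_e)
    then show ?thesis using assms(3) by simp
  qed
qed

end
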